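(* There exists a constant $C>0$ such that for every $n\ge 1$ and every $\beta\ge 0$, the mixing time $t_{\mathrm{mix}}$ of the logit dynamics with inverse noise $\beta$ for the $n$-player OR game satisfies: 1. $t_{\mathrm{mix}}\ge C e^{\beta}$ if $\beta<\log(2^n-1)$ (i.e. it is $\Omega(e^\beta)$); 2. $t_{\mathrm{mix}}\ge C\,2^n$ if $\beta>\log(2^n-1)$ (i.e. it is $\Omega(2^n)$). Here $\log$ is the natural logarithm.
   Context: OR game: $n$ players, each with strategy set $\{0,1\}$; for every player $i$, $u_i(\mathbf{x})=0$ if $\mathbf{x}=(0,\dots,0)$ and $u_i(\mathbf{x})=-1$ otherwise. Logit dynamics: for a strategic game with $n$ players, finite strategy sets $S_i$ and utilities $u_i:\prod_j S_j\to\mathbb{R}$, and for $\beta\ge 0$, let $\sigma_i(y\mid\mathbf{x})=e^{\beta u_i(\mathbf{x}_{-i},y)}/\sum_{z\in S_i}e^{\beta u_i(\mathbf{x}_{-i},z)}$, where $(\mathbf{x}_{-i},y)$ is $\mathbf{x}$ with its $i$-th entry replaced by $y$. The logit dynamics with inverse noise $\beta$ is the Markov chain on $\Omega=\prod_j S_j$ which, from profile $\mathbf{x}$, selects a player $i$ uniformly at random and replaces $x_i$ by $y\in S_i$ with probability $\sigma_i(y\mid\mathbf{x})$. It is irreducible and aperiodic; let $P$ be its transition matrix and $\pi$ its unique stationary distribution. The mixing time is $t_{\mathrm{mix}}=\min\{t\in\mathbb{N}:\max_{\mathbf{x}\in\Omega}\|P^t(\mathbf{x},\cdot)-\pi\|_{\mathrm{TV}}\le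 1/4\}$, where $\|\mu-\nu\|_{\mathrm{TV}}=\max_{A\subseteq\Omega}|\mu(A)-\nu(A)|$. *)

theory Defs
  imports Complex_Main "HOL-Library.FuncSet"
begin

section \<open>Markov chains on a finite state space\<close>

text \<open>
  A chain on a finite set \<open>\<Omega>\<close> is given by its transition matrix \<open>P\<close>, of which only the entries
  indexed by \<open>\<Omega>\<close> matter.
\<close>

fun transition_power :: "'s set \<Rightarrow> ('s \<Rightarrow> 's \<Rightarrow> real) \<Rightarrow> nat \<Rightarrow> 's \<Rightarrow> 's \<Rightarrow> real" where
  "transition_power \<Omega> P 0 x y = (if x = y then 1 else 0)"
| "transition_power \<Omega> P (Suc t) x y = (\<Sum>z\<in>\<Omega>. transition_power \<Omega> P t x z * P z y)"

text \<open>
  Distributions are required to vanish outside \<open>\<Omega>\<close>, so that a distribution on \<open>\<Omega>\<close> is represented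
  by exactly one function on the whole type and the definite description below makes sense.
\<close>

definition is_distribution :: "'s set \<Rightarrow> ('s \<Rightarrow> real) \<Rightarrow> bool" where
  "is_distribution \<Omega> \<mu> \<longleftrightarrow> (\<forall>x\<in>\<Omega>. \<mu> x \<ge> 0) \<and> (\<forall>x. x \<notin> \<Omega> \<longrightarrow> \<mu> x = 0) \<and> (\<Sum>x\<in>\<Omega>. \<mu> x) = 1"

definition is_stationary :: "'s set \<Rightarrow> ('s \<Rightarrow> 's \<Rightarrow> real) \<Rightarrow> ('s \<Rightarrow> real) \<Rightarrow> bool" where
  "is_stationary \<Omega> P \<mu> \<longleftrightarrow> is_distribution \<Omega> \<mu> \<and> (\<forall>y\<in>\<Omega>. (\<Sum>x\<in>\<Omega>. \<mu> x * P x y) = \<mu> y)"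

definition stationary_distribution :: "'s set \<Rightarrow> ('s \<Rightarrow> 's \<Rightarrow> real) \<Rightarrow> 's \<Rightarrow> real" where
  "stationary_distribution \<Omega> P = (THE \<mu>. is_stationary \<Omega> P \<mu>)"

definition tv_distance :: "'s set \<Rightarrow> ('s \<Rightarrow> real) \<Rightarrow> ('s \<Rightarrow> real) \<Rightarrow> real" where
  "tv_distance \<Omega> \<mu> \<nu> = (MAX A\<in>Pow \<Omega>. \<bar>(\<Sum>x\<in>A. \<mu> x) - (\<Sum>x\<in>A. \<nu> x)\<bar>)"

definition mixing_time :: "'s set \<Rightarrow> ('s \<Rightarrow> 's \<Rightarrow> real) \<Rightarrow> nat" where
  "mixing_time \<Omega> P =
     (LEAST t. (MAX x\<in>\<Omega>. tv_distance \<Omega> (transition_power \<Omega> P t x) (stationary_distribution \<Omega> P))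
                 \<le> 1 / 4)"

section \<open>Logit dynamics\<close>

text \<open>
  A strategic game has players \<open>{..<n}\<close>, finite strategy sets \<open>S i\<close> and utilities \<open>u i\<close>. Profiles
  are extensional functions on \<open>{..<n}\<close>, so \<open>x(i := y)\<close> is the profile with its \<open>i\<close>-th entry
  replaced by \<open>y\<close>.
\<close>

definition profiles :: "nat \<Rightarrow> (nat \<Rightarrow> 'a set) \<Rightarrow> (nat \<Rightarrow> 'a) set" where
  "profiles n S = (\<Pi>\<^sub>E i\<in>{..<n}. S i)"

definition logit_choice ::
  "(nat \<Rightarrow> 'a set) \<Rightarrow> (nat \<Rightarrow> (nat \<Rightarrow> 'a) \<Rightarrow> real) \<Rightarrow> real \<Rightarrow> nat \<Rightarrow> (nat \<Rightarrow> 'a) \<Rightarrow> 'a \<Rightarrow> real" where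
  "logit_choice S u \<beta> i x y =
     exp (\<beta> * u i (x(i := y))) / (\<Sum>z\<in>S i. exp (\<beta> * u i (x(i := z))))"

definition logit_transition ::
  "nat \<Rightarrow> (nat \<Rightarrow> 'a set) \<Rightarrow> (nat \<Rightarrow> (nat \<Rightarrow> 'a) \<Rightarrow> real) \<Rightarrow> real
     \<Rightarrow> (nat \<Rightarrow> 'a) \<Rightarrow> (nat \<Rightarrow> 'a) \<Rightarrow> real" where
  "logit_transition n S u \<beta> x y =
     (\<Sum>i<n. 1 / real n * (\<Sum>z\<in>S i. if x(i := z) = y then logit_choice S u \<beta> i x z else 0))"

definition logit_mixing_time ::
  "nat \<Rightarrow> (nat \<Rightarrow> 'a set) \<Rightarrow> (nat \<Rightarrow> (nat \<Rightarrow> 'a) \<Rightarrow> real) \<Rightarrow> real \<Rightarrow> nat" where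
  "logit_mixing_time n S u \<beta> = mixing_time (profiles n S) (logit_transition n S u \<beta>)"

section \<open>The OR game\<close>

definition or_strategies :: "nat \<Rightarrow> nat set" where
  "or_strategies i = {0, 1}"

definition or_utility :: "nat \<Rightarrow> nat \<Rightarrow> (nat \<Rightarrow> nat) \<Rightarrow> real" where
  "or_utility n i x = (if \<forall>j<n. x j = 0 then 0 else -1)"

end

theory Submission
  imports Defs
begin

text \<open>
  The chain is reversible with respect to the Gibbs measure, which gives mass \<open>1 / Z\<close> to the zero
  profile and \<open>exp (- \<beta>) / Z\<close> to every other one, where \<open>Z = 1 + (2 ^ n - 1) * exp (- \<beta>)\<close>.
  The stationary flow between the zero profile and its complement is at most \<open>exp (- \<beta>) / Z\<close>.
  Whichever of the two sides has stationary mass at most \<open>1 / 2\<close> (this is decided by comparing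
  \<open>\<beta>\<close> with \<open>ln (2 ^ n - 1)\<close>) is a bottleneck: within \<open>t\<close> steps at most \<open>t\<close> times the flow can
  leave it, whereas at the mixing time at least a quarter of its mass has left.  That the mixing
  time is a genuine minimum follows from Doeblin's minorisation condition, since in \<open>n\<close> steps
  every profile can be reached from every other one.
\<close>

section \<open>Finite Markov chains\<close>

locale finite_markov_chain =
  fixes \<Omega> :: "'s set" and P :: "'s \<Rightarrow> 's \<Rightarrow> real"
  assumes finite_states: "finite \<Omega>"
    and nonneg: "\<And>x y. x \<in> \<Omega> \<Longrightarrow> y \<in> \<Omega> \<Longrightarrow> P x y \<ge> 0"
    and row_sum: "\<And>x. x \<in> \<Omega> \<Longrightarrow> (\<Sum>y\<in>\<Omega>. P x y) = 1"
begin

abbreviation P_pow :: "nat \<Rightarrow> 's \<Rightarrow> 's \<Rightarrow> real" where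
  "P_pow \<equiv> transition_power \<Omega> P"

section \<open>Powers of the transition matrix\<close>

lemma P_pow_nonneg: "x \<in> \<Omega> \<Longrightarrow> y \<in> \<Omega> \<Longrightarrow> P_pow t x y \<ge> 0"
  by (induction t arbitrary: y) (auto intro!: sum_nonneg mult_nonneg_nonneg nonneg)

lemma P_pow_row_sum:
  assumes "x \<in> \<Omega>" shows "(\<Sum>y\<in>\<Omega>. P_pow t x y) = 1"
proof (induction t)
  case 0
  then show ?case using assms finite_states by simp
next
  case (Suc t)
  have "(\<Sum>y\<in>\<Omega>. P_pow (Suc t) x y) = (\<Sum>z\<in>\<Omega>. P_pow t x z * (\<Sum>y\<in>\<Omega>. P z y))"
    unfolding transition_power.simps sum_distrib_left by (rule sum.swap)
  also have "\<dots> = 1"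
    using Suc by (simp add: row_sum)
  finally show ?case .
qed

lemma P_pow_add:
  assumes "y \<in> \<Omega>"
  shows "P_pow (s + t) x y = (\<Sum>z\<in>\<Omega>. P_pow s x z * P_pow t z y)"
  using assms
proof (induction t arbitrary: y)
  case 0
  then show ?case using finite_states by (simp add: if_distrib cong: if_cong)
next
  case (Suc t)
  have "P_pow (s + Suc t) x y = (\<Sum>w\<in>\<Omega>. (\<Sum>z\<in>\<Omega>. P_pow s x z * P_pow t z w) * P w y)"
    using Suc.IH by simp
  also have "\<dots> = (\<Sum>w\<in>\<Omega>. \<Sum>z\<in>\<Omega>. P_pow s x z * (P_pow t z w * P w y))"
    by (simp add: sum_distrib_right mult.assoc)
  also have "\<dots> = (\<Sum>z\<in>\<Omega>. P_pow s x z * P_pow (Suc t) z y)"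
    unfolding transition_power.simps sum_distrib_left by (rule sum.swap)
  finally show ?case .
qed

lemma stationary_P_pow:
  assumes "is_stationary \<Omega> P \<mu>" "y \<in> \<Omega>"
  shows "(\<Sum>x\<in>\<Omega>. \<mu> x * P_pow t x y) = \<mu> y"
  using assms(2)
proof (induction t arbitrary: y)
  case 0
  then show ?case using finite_states by (simp add: if_distrib cong: if_cong)
next
  case (Suc t)
  have "(\<Sum>x\<in>\<Omega>. \<mu> x * P_pow (Suc t) x y) = (\<Sum>z\<in>\<Omega>. (\<Sum>x\<in>\<Omega>. \<mu> x * P_pow t x z) * P z y)"
    unfolding transition_power.simps sum_distrib_left sum_distrib_right mult.assoc
    by (rule sum.swap)
  also have "\<dots> = \<mu> y"
    using Suc assms(1) by (simp add: is_stationary_def)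
  finally show ?case .
qed

section \<open>Doeblin's condition: convergence, uniqueness, and attainment of the mixing
  time\<close>

text \<open>After \<open>k\<close> rounds of \<open>r\<close> steps the row is
  \<open>(1 - c) * \<mu>\<close> plus a nonnegative remainder \<open>E\<close> of total mass
  \<open>c = (1 - \<delta>) ^ k\<close>. The next round preserves the first part by stationarity and
  turns the remainder into at least \<open>c * \<delta> * \<mu>\<close>, so the coefficient of
  \<open>\<mu>\<close> becomes \<open>1 - c * (1 - \<delta>)\<close>.\<close>

lemma doeblin_minorisation:
  assumes stat: "is_stationary \<Omega> P \<mu>"
    and minor: "\<And>x y. x \<in> \<Omega> \<Longrightarrow> y \<in> \<Omega> \<Longrightarrow> \<delta> * \<mu> y \<le> P_pow r x y"
    and "x \<in> \<Omega>" "y \<in> \<Omega>"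
  shows "(1 - (1 - \<delta>) ^ k) * \<mu> y \<le> P_pow (k * r) x y"
  using \<open>y \<in> \<Omega>\<close>
proof (induction k arbitrary: y)
  case 0
  then show ?case by simp
next
  case (Suc k)
  define c where "c = (1 - \<delta>) ^ k"
  define E where "E z = P_pow (k * r) x z - (1 - c) * \<mu> z" for z
  have E_nonneg: "E z \<ge> 0" if "z \<in> \<Omega>" for z
    using Suc.IH[OF that] by (simp add: E_def c_def)
  have "(\<Sum>z\<in>\<Omega>. \<mu> z) = 1"
    using stat by (simp add: is_stationary_def is_distribution_def)
  then have E_sum: "(\<Sum>z\<in>\<Omega>. E z) = c"
    using P_pow_row_sum[OF \<open>x \<in> \<Omega>\<close>] unfolding E_def
    by (simp add: sum_subtractf flip: sum_distrib_left)
  have "(\<Sum>z\<in>\<Omega>. E z * (\<delta> * \<mu> y)) \<le> (\<Sum>z\<in>\<Omega>. E z * P_pow r z y)"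
    using minor Suc.prems E_nonneg by (intro sum_mono mult_left_mono) auto
  then have "c * (\<delta> * \<mu> y) \<le> (\<Sum>z\<in>\<Omega>. E z * P_pow r z y)"
    by (simp add: E_sum flip: sum_distrib_right)
  also have "\<dots> = (\<Sum>z\<in>\<Omega>. P_pow (k * r) x z * P_pow r z y) - (1 - c) * (\<Sum>z\<in>\<Omega>. \<mu> z * P_pow r z y)"
    unfolding E_def by (simp add: left_diff_distrib sum_subtractf sum_distrib_left mult.assoc)
  also have "\<dots> = P_pow (k * r + r) x y - (1 - c) * \<mu> y"
    using P_pow_add stationary_P_pow[OF stat] Suc.prems by simp
  finally show ?case
    by (simp add: c_def algebra_simps)
qed

text \<open>A one-sided pointwise bound suffices: summed over \<open>A\<close> it bounds the row's
  mass on \<open>A\<close> from below, and summed over the complement it bounds that mass from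
  above, since both total masses are 1.\<close>

lemma tv_distance_le:
  assumes "is_distribution \<Omega> \<mu>" "x \<in> \<Omega>"
    and "\<And>y. y \<in> \<Omega> \<Longrightarrow> (1 - c) * \<mu> y \<le> P_pow t x y" and "c \<ge> 0"
  shows "tv_distance \<Omega> (P_pow t x) \<mu> \<le> c"
proof -
  have \<mu>: "\<And>y. y \<in> \<Omega> \<Longrightarrow> \<mu> y \<ge> 0" "(\<Sum>y\<in>\<Omega>. \<mu> y) = 1"
    using assms(1) by (auto simp: is_distribution_def)
  have lower: "(\<Sum>y\<in>A. \<mu> y) - c \<le> (\<Sum>y\<in>A. P_pow t x y)" if "A \<subseteq> \<Omega>" for A
  proof -
    have "(\<Sum>y\<in>A. \<mu> y) \<le> 1"
      using sum_mono2[OF finite_states that, of \<mu>] \<mu> by auto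
    then have "c * (\<Sum>y\<in>A. \<mu> y) \<le> c"
      using \<open>c \<ge> 0\<close> mult_left_mono by fastforce
    moreover have "(\<Sum>y\<in>A. (1 - c) * \<mu> y) \<le> (\<Sum>y\<in>A. P_pow t x y)"
      using assms(3) that by (intro sum_mono) auto
    ultimately show ?thesis
      by (simp add: algebra_simps sum_subtractf flip: sum_distrib_left)
  qed
  have "\<bar>(\<Sum>y\<in>A. P_pow t x y) - (\<Sum>y\<in>A. \<mu> y)\<bar> \<le> c" if "A \<subseteq> \<Omega>" for A
    using lower[OF that] lower[of "\<Omega> - A"] \<mu>(2) P_pow_row_sum[OF assms(2), of t]
      sum.subset_diff[OF that finite_states, of \<mu>]
      sum.subset_diff[OF that finite_states, of "P_pow t x"]
    by auto
  then show ?thesis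
    unfolding tv_distance_def using finite_states by (subst Max_le_iff) auto
qed

text \<open>Evaluates the definite description. A stationary \<open>\<nu>\<close> is a
  \<open>\<nu>\<close>-average of the rows of every power, so it inherits their Doeblin lower bound;
  letting \<open>k\<close> grow gives \<open>\<mu> y \<le> \<nu> y\<close>, and equal total masses
  force equality.\<close>

lemma stationary_distribution_eq:
  assumes stat: "is_stationary \<Omega> P \<mu>"
    and minor: "\<And>x y. x \<in> \<Omega> \<Longrightarrow> y \<in> \<Omega> \<Longrightarrow> \<delta> * \<mu> y \<le> P_pow r x y"
    and "0 < \<delta>" "\<delta> \<le> 1"
  shows "stationary_distribution \<Omega> P = \<mu>"
  unfolding stationary_distribution_def
proof (rule the_equality, rule stat)
  fix \<nu>
  assume \<nu>: "is_stationary \<Omega> P \<nu>"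
  have le: "\<mu> y \<le> \<nu> y" if "y \<in> \<Omega>" for y
  proof (rule LIMSEQ_le_const2)
    have "(\<lambda>k. (1 - (1 - \<delta>) ^ k) * \<mu> y) \<longlonglongrightarrow> (1 - 0) * \<mu> y"
      using assms(3,4) by (intro tendsto_intros LIMSEQ_realpow_zero) auto
    then show "(\<lambda>k. (1 - (1 - \<delta>) ^ k) * \<mu> y) \<longlonglongrightarrow> \<mu> y" by simp
    have "(1 - (1 - \<delta>) ^ k) * \<mu> y \<le> \<nu> y" for k
    proof -
      have "(1 - (1 - \<delta>) ^ k) * \<mu> y = (\<Sum>x\<in>\<Omega>. \<nu> x * ((1 - (1 - \<delta>) ^ k) * \<mu> y))"
        using \<nu> by (simp add: is_stationary_def is_distribution_def flip: sum_distrib_right)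
      also have "\<dots> \<le> (\<Sum>x\<in>\<Omega>. \<nu> x * P_pow (k * r) x y)"
        using doeblin_minorisation[OF stat minor] \<nu> that
        by (intro sum_mono mult_left_mono) (auto simp: is_stationary_def is_distribution_def)
      also have "\<dots> = \<nu> y"
        using stationary_P_pow[OF \<nu> that] .
      finally show ?thesis .
    qed
    then show "\<exists>N. \<forall>k\<ge>N. (1 - (1 - \<delta>) ^ k) * \<mu> y \<le> \<nu> y" by blast
  qed
  have "(\<Sum>y\<in>\<Omega>. \<nu> y - \<mu> y) = 0"
    using stat \<nu> by (simp add: is_stationary_def is_distribution_def sum_subtractf)
  then have "\<forall>y\<in>\<Omega>. \<nu> y - \<mu> y = 0"
    using le finite_states by (subst (asm) sum_nonneg_eq_0_iff) auto
  \<comment> \<open>Distributions vanish outside \<open>\<Omega>\<close>, so agreement on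
    \<open>\<Omega>\<close> is equality of functions.\<close>
  then show "\<nu> = \<mu>"
    using stat \<nu> by (auto simp: is_stationary_def is_distribution_def fun_eq_iff)
qed

text \<open>The \<open>LEAST\<close> in \<open>mixing_time\<close> has the required property only
  once some time is known to qualify; \<open>k * r\<close> does as soon as
  \<open>(1 - \<delta>) ^ k < 1 / 4\<close>.\<close>

lemma tv_distance_mixing_time:
  assumes stat: "is_stationary \<Omega> P \<mu>"
    and minor: "\<And>x y. x \<in> \<Omega> \<Longrightarrow> y \<in> \<Omega> \<Longrightarrow> \<delta> * \<mu> y \<le> P_pow r x y"
    and "0 < \<delta>" "\<delta> \<le> 1" "x \<in> \<Omega>"
  shows "tv_distance \<Omega> (P_pow (mixing_time \<Omega> P) x) \<mu> \<le> 1 / 4"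
proof -
  define M where "M t = (MAX x\<in>\<Omega>. tv_distance \<Omega> (P_pow t x) \<mu>)" for t
  \<comment> \<open>The state \<open>x\<close> ensures that the maximum ranges over a nonempty
    set.\<close>
  have M_le_iff: "M t \<le> c \<longleftrightarrow> (\<forall>x\<in>\<Omega>. tv_distance \<Omega> (P_pow t x) \<mu> \<le> c)" for t c
    unfolding M_def using finite_states \<open>x \<in> \<Omega>\<close> by (subst Max_le_iff) auto
  obtain k where k: "(1 - \<delta>) ^ k < 1 / 4"
    using real_arch_pow_inv[of "1 / 4" "1 - \<delta>"] assms(3,4) by auto
  have "M (k * r) \<le> (1 - \<delta>) ^ k"
    unfolding M_le_iff
    using stat doeblin_minorisation[OF stat minor] assms(3,4)
    by (auto intro!: tv_distance_le simp: is_stationary_def)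
  then have "M (k * r) \<le> 1 / 4" using k by simp
  then have "M (LEAST t. M t \<le> 1 / 4) \<le> 1 / 4" by (rule LeastI)
  moreover have "stationary_distribution \<Omega> P = \<mu>"
    using stat minor assms(3,4) by (rule stationary_distribution_eq)
  then have "mixing_time \<Omega> P = (LEAST t. M t \<le> 1 / 4)"
    by (simp add: mixing_time_def M_def)
  ultimately show ?thesis
    using M_le_iff \<open>x \<in> \<Omega>\<close> by metis
qed

section \<open>Flow out of a set and the bottleneck bound\<close>

text \<open>Mass that starts in \<open>A\<close> and is outside after \<open>t + 1\<close> steps was
  either already outside after \<open>t\<close> steps or crosses in the last step. The crossing mass
  is at most one stationary flow, because the mass started from \<open>A\<close> never exceeds
  \<open>\<mu>\<close> at any state.\<close>

lemma flow_P_pow_le: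
  assumes stat: "is_stationary \<Omega> P \<mu>" and "A \<subseteq> \<Omega>"
  shows "(\<Sum>x\<in>A. \<Sum>y\<in>\<Omega>-A. \<mu> x * P_pow t x y) \<le> real t * (\<Sum>x\<in>A. \<Sum>y\<in>\<Omega>-A. \<mu> x * P x y)"
proof (induction t)
  case 0
  have "(\<Sum>x\<in>A. \<Sum>y\<in>\<Omega>-A. \<mu> x * P_pow 0 x y) = 0"
    by (intro sum.neutral ballI) auto
  then show ?case by simp
next
  case (Suc t)
  have \<mu>: "\<mu> x \<ge> 0" if "x \<in> \<Omega>" for x
    using stat that by (simp add: is_stationary_def is_distribution_def)
  have fin: "finite A" "finite (\<Omega> - A)"
    using finite_subset[OF \<open>A \<subseteq> \<Omega>\<close> finite_states] finite_states by auto
  \<comment> \<open>\<open>h z\<close> is the mass at \<open>z\<close> after \<open>t\<close> steps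
    when the chain starts from \<open>\<mu>\<close> restricted to \<open>A\<close>;
    \<open>out z\<close> is the probability of landing outside \<open>A\<close> in one step from
    \<open>z\<close>.\<close>
  define h where "h z = (\<Sum>x\<in>A. \<mu> x * P_pow t x z)" for z
  define out where "out z = (\<Sum>y\<in>\<Omega>-A. P z y)" for z
  have h_nonneg: "h z \<ge> 0" if "z \<in> \<Omega>" for z
    unfolding h_def using \<open>A \<subseteq> \<Omega>\<close> that
    by (intro sum_nonneg mult_nonneg_nonneg \<mu> P_pow_nonneg) auto
  have h_le: "h z \<le> \<mu> z" if "z \<in> \<Omega>" for z
    unfolding h_def stationary_P_pow[OF stat that, of t, symmetric]
    using \<open>A \<subseteq> \<Omega>\<close> that finite_states
    by (intro sum_mono2 mult_nonneg_nonneg \<mu> P_pow_nonneg) auto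
  have out_nonneg: "out z \<ge> 0" if "z \<in> \<Omega>" for z
    unfolding out_def using that by (intro sum_nonneg nonneg) auto
  have out_le: "out z \<le> 1" if "z \<in> \<Omega>" for z
    unfolding out_def row_sum[OF that, symmetric]
    using that finite_states by (intro sum_mono2 nonneg) auto
  have "(\<Sum>x\<in>A. \<Sum>y\<in>\<Omega>-A. \<mu> x * P_pow (Suc t) x y) = (\<Sum>x\<in>A. \<Sum>y\<in>\<Omega>-A. \<Sum>z\<in>\<Omega>. \<mu> x * P_pow t x z * P z y)"
    by (simp add: sum_distrib_left mult.assoc)
  also have "\<dots> = (\<Sum>x\<in>A. \<Sum>z\<in>\<Omega>. \<Sum>y\<in>\<Omega>-A. \<mu> x * P_pow t x z * P z y)"
    by (intro sum.cong refl sum.swap)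
  also have "\<dots> = (\<Sum>z\<in>\<Omega>. \<Sum>x\<in>A. \<Sum>y\<in>\<Omega>-A. \<mu> x * P_pow t x z * P z y)"
    by (rule sum.swap)
  also have "\<dots> = (\<Sum>z\<in>\<Omega>. h z * out z)"
    unfolding h_def out_def by (simp add: sum_product)
  also have "\<dots> = (\<Sum>z\<in>\<Omega>-A. h z * out z) + (\<Sum>z\<in>A. h z * out z)"
    by (rule sum.subset_diff[OF \<open>A \<subseteq> \<Omega>\<close> finite_states])
  \<comment> \<open>Outside \<open>A\<close> the factor \<open>out z\<close> is bounded by 1; inside
    \<open>A\<close>, \<open>h z\<close> is bounded by \<open>\<mu> z\<close>.\<close>
  also have "\<dots> \<le> (\<Sum>z\<in>\<Omega>-A. h z) + (\<Sum>z\<in>A. \<mu> z * out z)"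
    using \<open>A \<subseteq> \<Omega>\<close> h_le h_nonneg out_le out_nonneg
    by (intro add_mono sum_mono mult_right_mono mult_left_le) auto
  also have "(\<Sum>z\<in>\<Omega>-A. h z) = (\<Sum>x\<in>A. \<Sum>y\<in>\<Omega>-A. \<mu> x * P_pow t x y)"
    unfolding h_def by (rule sum.swap)
  also have "(\<Sum>z\<in>A. \<mu> z * out z) = (\<Sum>x\<in>A. \<Sum>y\<in>\<Omega>-A. \<mu> x * P x y)"
    unfolding out_def by (simp add: sum_distrib_left)
  finally show ?case
    using Suc by (simp add: algebra_simps)
qed

text \<open>The complement of \<open>A\<close> has stationary mass at least 1/2. Testing total
  variation on it shows that, at the mixing time, the chain from any state of \<open>A\<close> is
  outside with probability at least 1/2 - 1/4. Averaging over \<open>A\<close> and comparing with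
  the flow bound gives the factor 4.\<close>

lemma mixing_time_bottleneck:
  assumes stat: "is_stationary \<Omega> P \<mu>"
    and minor: "\<And>x y. x \<in> \<Omega> \<Longrightarrow> y \<in> \<Omega> \<Longrightarrow> \<delta> * \<mu> y \<le> P_pow r x y"
    and "0 < \<delta>" "\<delta> \<le> 1"
    and "A \<subseteq> \<Omega>" "(\<Sum>x\<in>A. \<mu> x) \<le> 1 / 2"
  shows "(\<Sum>x\<in>A. \<mu> x) \<le> 4 * real (mixing_time \<Omega> P) * (\<Sum>x\<in>A. \<Sum>y\<in>\<Omega>-A. \<mu> x * P x y)"
proof -
  let ?t = "mixing_time \<Omega> P"
  have \<mu>: "\<And>x. x \<in> \<Omega> \<Longrightarrow> \<mu> x \<ge> 0" "(\<Sum>x\<in>\<Omega>. \<mu> x) = 1"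
    using stat by (auto simp: is_stationary_def is_distribution_def)
  have leave: "1 / 4 \<le> (\<Sum>y\<in>\<Omega>-A. P_pow ?t x y)" if "x \<in> A" for x
  proof -
    have "\<bar>(\<Sum>y\<in>\<Omega>-A. P_pow ?t x y) - (\<Sum>y\<in>\<Omega>-A. \<mu> y)\<bar> \<le> tv_distance \<Omega> (P_pow ?t x) \<mu>"
      unfolding tv_distance_def using finite_states by (intro Max_ge) auto
    also have "\<dots> \<le> 1 / 4"
      using that \<open>A \<subseteq> \<Omega>\<close> by (intro tv_distance_mixing_time[OF stat minor assms(3,4)]) auto
    finally show ?thesis
      using sum.subset_diff[OF \<open>A \<subseteq> \<Omega>\<close> finite_states, of \<mu>] \<mu>(2) assms(6) by linarith
  qed
  have "(\<Sum>x\<in>A. \<mu> x) / 4 = (\<Sum>x\<in>A. \<mu> x * (1 / 4))"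
    by (simp add: sum_divide_distrib)
  also have "\<dots> \<le> (\<Sum>x\<in>A. \<mu> x * (\<Sum>y\<in>\<Omega>-A. P_pow ?t x y))"
    using leave \<mu>(1) \<open>A \<subseteq> \<Omega>\<close> by (intro sum_mono mult_left_mono) auto
  also have "\<dots> = (\<Sum>x\<in>A. \<Sum>y\<in>\<Omega>-A. \<mu> x * P_pow ?t x y)"
    by (simp add: sum_distrib_left)
  also have "\<dots> \<le> real ?t * (\<Sum>x\<in>A. \<Sum>y\<in>\<Omega>-A. \<mu> x * P x y)"
    by (rule flow_P_pow_le[OF stat \<open>A \<subseteq> \<Omega>\<close>])
  finally show ?thesis by simp
qed

end

section \<open>Logit dynamics\<close>

lemma profiles_update: "x \<in> profiles n S \<Longrightarrow> i < n \<Longrightarrow> z \<in> S i \<Longrightarrow> x(i := z) \<in> profiles n S"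
  by (auto simp: profiles_def PiE_iff extensional_def)

lemma finite_profiles: "(\<And>i. i < n \<Longrightarrow> finite (S i)) \<Longrightarrow> finite (profiles n S)"
  unfolding profiles_def by (intro finite_PiE) auto

section \<open>Logit dynamics as a Markov chain with strictly positive \<open>n\<close>-step
  transitions\<close>

locale finite_game =
  fixes n :: nat and S :: "nat \<Rightarrow> 'a set"
  assumes players: "n \<ge> 1"
    and finite_strategies: "\<And>i. i < n \<Longrightarrow> finite (S i)"
    and nonempty_strategies: "\<And>i. i < n \<Longrightarrow> S i \<noteq> {}"
begin

lemma partition_pos: "i < n \<Longrightarrow> (\<Sum>z\<in>S i. exp (\<beta> * u i (x(i := z)))) > (0::real)"
  using finite_strategies nonempty_strategies by (intro sum_pos) auto

lemma logit_choice_pos: "i < n \<Longrightarrow> logit_choice S u \<beta> i x z > 0"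
  unfolding logit_choice_def using partition_pos by (intro divide_pos_pos) auto

lemma sum_logit_choice: "i < n \<Longrightarrow> (\<Sum>z\<in>S i. logit_choice S u \<beta> i x z) = 1"
  unfolding logit_choice_def
  using partition_pos[of i \<beta> u x] by (simp flip: sum_divide_distrib)

lemma logit_transition_nonneg: "logit_transition n S u \<beta> x y \<ge> 0"
  unfolding logit_transition_def
  by (intro sum_nonneg mult_nonneg_nonneg) (auto intro: less_imp_le[OF logit_choice_pos])

lemma logit_transition_update_pos:
  assumes "i < n" "z \<in> S i"
  shows "logit_transition n S u \<beta> x (x(i := z)) > 0"
  unfolding logit_transition_def
proof (rule sum_pos2[of _ i])
  have "0 < logit_choice S u \<beta> i x z" using assms by (simp add: logit_choice_pos)
  also have "\<dots> \<le> (\<Sum>z'\<in>S i. if x(i := z') = x(i := z) then logit_choice S u \<beta> i x z' else 0)"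
  proof -
    let ?f = "\<lambda>z'. if x(i := z') = x(i := z) then logit_choice S u \<beta> i x z' else 0"
    have "?f z \<le> (\<Sum>z'\<in>S i. ?f z')"
      using assms finite_strategies
      by (intro member_le_sum) (auto intro: less_imp_le[OF logit_choice_pos])
    then show ?thesis by simp
  qed
  finally show "0 < 1 / real n * (\<Sum>z'\<in>S i. if x(i := z') = x(i := z) then logit_choice S u \<beta> i x z' else 0)"
    using players by simp
qed (use assms in \<open>auto intro!: divide_nonneg_nonneg sum_nonneg intro: less_imp_le[OF logit_choice_pos]\<close>)

lemma logit_chain: "finite_markov_chain (profiles n S) (logit_transition n S u \<beta>)"
proof
  show "finite (profiles n S)" using finite_strategies by (rule finite_profiles)
  show "logit_transition n S u \<beta> x y \<ge> 0" for x y by (rule logit_transition_nonneg)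
  fix x assume x: "x \<in> profiles n S"
  have "(\<Sum>y\<in>profiles n S. logit_transition n S u \<beta> x y)
      = (\<Sum>i<n. \<Sum>y\<in>profiles n S. 1 / real n * (\<Sum>z\<in>S i. if x(i := z) = y then logit_choice S u \<beta> i x z else 0))"
    unfolding logit_transition_def by (rule sum.swap)
  also have "\<dots> = (\<Sum>i<n. 1 / real n)"
  proof (intro sum.cong refl)
    fix i assume "i \<in> {..<n}"
    then have i: "i < n" by simp
    have "(\<Sum>y\<in>profiles n S. \<Sum>z\<in>S i. if x(i := z) = y then logit_choice S u \<beta> i x z else 0)
        = (\<Sum>z\<in>S i. \<Sum>y\<in>profiles n S. if x(i := z) = y then logit_choice S u \<beta> i x z else 0)"
      by (rule sum.swap)
    \<comment> \<open>Each update stays inside the profile space, so exactly one \<open>y\<close>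
      contributes for each \<open>z\<close>.\<close>
    also have "\<dots> = (\<Sum>z\<in>S i. logit_choice S u \<beta> i x z)"
      using finite_profiles[of n S] finite_strategies profiles_update[OF x i]
      by (intro sum.cong refl) simp
    also have "\<dots> = 1" using i by (rule sum_logit_choice)
    finally show "(\<Sum>y\<in>profiles n S. 1 / real n * (\<Sum>z\<in>S i. if x(i := z) = y then logit_choice S u \<beta> i x z else 0)) = 1 / real n"
      by (simp flip: sum_divide_distrib)
  qed
  also have "\<dots> = 1" using players by simp
  finally show "(\<Sum>y\<in>profiles n S. logit_transition n S u \<beta> x y) = 1" .
qed

text \<open>Follow the path that rewrites the entries of \<open>x\<close> into those of
  \<open>y\<close> one player at a time. An update that keeps an entry also has positive
  probability, so the path has exactly \<open>n\<close> steps for every pair.\<close>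

lemma logit_transition_power_pos:
  assumes x: "x \<in> profiles n S" and y: "y \<in> profiles n S"
  shows "transition_power (profiles n S) (logit_transition n S u \<beta>) n x y > 0"
proof -
  interpret finite_markov_chain "profiles n S" "logit_transition n S u \<beta>" by (rule logit_chain)
  \<comment> \<open>Hybrid profiles: players below \<open>k\<close> already play as in
    \<open>y\<close>. At \<open>k = n\<close> extensionality makes the hybrid equal to
    \<open>y\<close>.\<close>
  define w where "w k = (\<lambda>j. if j < k then y j else x j)" for k
  have w_Suc: "w (Suc k) = (w k)(k := y k)" for k
    by (auto simp: w_def less_Suc_eq fun_eq_iff)
  have w_in: "w k \<in> profiles n S" if "k \<le> n" for k
    using x y that by (auto simp: w_def profiles_def PiE_iff extensional_def)
  have y_in: "y k \<in> S k" if "k < n" for k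
    using y that by (auto simp: profiles_def)
  have "P_pow k x (w k) > 0" if "k \<le> n" for k
    using that
  proof (induction k)
    case 0
    then show ?case by (simp add: w_def)
  next
    case (Suc k)
    have "0 < P_pow k x (w k) * logit_transition n S u \<beta> (w k) (w (Suc k))"
      using Suc y_in[of k] logit_transition_update_pos[of k "y k"] by (simp add: w_Suc)
    also have "\<dots> \<le> P_pow (Suc k) x (w (Suc k))"
      unfolding transition_power.simps
      using Suc.prems w_in x finite_states
      by (intro member_le_sum mult_nonneg_nonneg P_pow_nonneg logit_transition_nonneg) auto
    finally show ?case .
  qed
  moreover have "w n = y"
    using x y by (auto simp: w_def profiles_def PiE_iff extensional_def fun_eq_iff)
  ultimately show ?thesis by (metis order_refl)
qed

lemma logit_minorisation:
  assumes "is_distribution (profiles n S) \<mu>"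
  obtains \<delta> where "0 < \<delta>" "\<delta> \<le> 1"
    "\<And>x y. x \<in> profiles n S \<Longrightarrow> y \<in> profiles n S \<Longrightarrow>
       \<delta> * \<mu> y \<le> transition_power (profiles n S) (logit_transition n S u \<beta>) n x y"
proof -
  interpret finite_markov_chain "profiles n S" "logit_transition n S u \<beta>" by (rule logit_chain)
  \<comment> \<open>Including 1 among the values forces \<open>\<delta> \<le> 1\<close>. Since
    \<open>\<mu> y \<le> 1\<close>, the smallest \<open>n\<close>-step probability then serves as a
    Doeblin constant.\<close>
  let ?V = "insert 1 ((\<lambda>(x, y). P_pow n x y) ` (profiles n S \<times> profiles n S))"
  define \<delta> where "\<delta> = Min ?V"
  have fin: "finite ?V" using finite_states by simp
  have "\<delta> > 0"
    unfolding \<delta>_def using fin logit_transition_power_pos by (subst Min_gr_iff) auto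
  moreover have "\<delta> \<le> 1"
    unfolding \<delta>_def using fin by (intro Min_le) auto
  moreover have "\<delta> * \<mu> y \<le> P_pow n x y" if "x \<in> profiles n S" "y \<in> profiles n S" for x y
  proof -
    have "\<mu> y \<le> (\<Sum>z\<in>profiles n S. \<mu> z)"
      using assms that finite_states by (intro member_le_sum) (auto simp: is_distribution_def)
    then have "\<mu> y \<le> 1" using assms by (simp add: is_distribution_def)
    then have "\<delta> * \<mu> y \<le> \<delta>" using \<open>\<delta> > 0\<close> by simp
    also have "\<delta> \<le> P_pow n x y"
      unfolding \<delta>_def using fin that by (intro Min_le) auto
    finally show ?thesis .
  qed
  ultimately show ?thesis using that by blast
qed

end

section \<open>Reversibility for games with a common utility\<close>

text \<open>
  Games in which all players share one utility function \<open>U\<close> have \<open>U\<close> as an exact potential, so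
  the logit dynamics is reversible with respect to the weights \<open>exp (\<beta> * U x)\<close>.
\<close>

definition gibbs :: "'s set \<Rightarrow> ('s \<Rightarrow> real) \<Rightarrow> real \<Rightarrow> 's \<Rightarrow> real" where
  "gibbs \<Omega> U \<beta> x = (if x \<in> \<Omega> then exp (\<beta> * U x) / (\<Sum>y\<in>\<Omega>. exp (\<beta> * U y)) else 0)"

lemma gibbs_distribution:
  assumes "finite \<Omega>" "\<Omega> \<noteq> {}"
  shows "is_distribution \<Omega> (gibbs \<Omega> U \<beta>)"
proof -
  have "(\<Sum>y\<in>\<Omega>. exp (\<beta> * U y)) > 0" using assms by (intro sum_pos) auto
  then show ?thesis
    by (simp add: is_distribution_def gibbs_def flip: sum_divide_distrib)
qed

context finite_game
begin

text \<open>For each player only \<open>z = y i\<close> can lead to \<open>y\<close>. The resulting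
  form suits detailed balance: the numerator depends only on the target, and the denominator is
  unaffected by the current entry of player \<open>i\<close>.\<close>

lemma logit_transition_common:
  assumes "y \<in> profiles n S"
  shows "logit_transition n S (\<lambda>_. U) \<beta> x y
    = (\<Sum>i<n. if x(i := y i) = y then exp (\<beta> * U y) / (\<Sum>z\<in>S i. exp (\<beta> * U (x(i := z)))) / real n else 0)"
  unfolding logit_transition_def
proof (intro sum.cong refl)
  fix i assume "i \<in> {..<n}"
  then have i: "i < n" "y i \<in> S i" using assms by (auto simp: profiles_def)
  have *: "(x(i := z) = y) \<longleftrightarrow> z = y i \<and> x(i := y i) = y" for z by auto
  have "(\<Sum>z\<in>S i. if x(i := z) = y then logit_choice S (\<lambda>_. U) \<beta> i x z else 0)
      = (\<Sum>z\<in>S i. if y i = z then (if x(i := y i) = y then logit_choice S (\<lambda>_. U) \<beta> i x (y i) else 0) else 0)"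
    using * by (intro sum.cong refl) (metis (full_types))
  also have "\<dots> = (if x(i := y i) = y then logit_choice S (\<lambda>_. U) \<beta> i x (y i) else 0)"
    using i finite_strategies by simp
  finally show "1 / real n * (\<Sum>z\<in>S i. if x(i := z) = y then logit_choice S (\<lambda>_. U) \<beta> i x z else 0)
      = (if x(i := y i) = y then exp (\<beta> * U y) / (\<Sum>z\<in>S i. exp (\<beta> * U (x(i := z)))) / real n else 0)"
    by (simp add: logit_choice_def)
qed

text \<open>The balance holds player by player. If changing entry \<open>i\<close> takes
  \<open>x\<close> to \<open>y\<close>, both profiles have the same updates at \<open>i\<close>,
  hence the same denominator, and the product of the two exponential weights is symmetric.\<close>

lemma detailed_balance:
  assumes "x \<in> profiles n S" "y \<in> profiles n S"
  shows "gibbs (profiles n S) U \<beta> x * logit_transition n S (\<lambda>_. U) \<beta> x y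
       = gibbs (profiles n S) U \<beta> y * logit_transition n S (\<lambda>_. U) \<beta> y x"
proof -
  have "exp (\<beta> * U x) * logit_transition n S (\<lambda>_. U) \<beta> x y
      = exp (\<beta> * U y) * logit_transition n S (\<lambda>_. U) \<beta> y x"
    unfolding logit_transition_common[OF assms(1)] logit_transition_common[OF assms(2)] sum_distrib_left
  proof (intro sum.cong refl)
    fix i assume "i \<in> {..<n}"
    have iff: "x(i := y i) = y \<longleftrightarrow> y(i := x i) = x" by (auto simp: fun_eq_iff)
    have upd: "x(i := z) = y(i := z)" if "x(i := y i) = y" for z
      using that by (metis fun_upd_upd)
    show "exp (\<beta> * U x) * (if x(i := y i) = y then exp (\<beta> * U y) / (\<Sum>z\<in>S i. exp (\<beta> * U (x(i := z)))) / real n else 0)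
        = exp (\<beta> * U y) * (if y(i := x i) = x then exp (\<beta> * U x) / (\<Sum>z\<in>S i. exp (\<beta> * U (y(i := z)))) / real n else 0)"
      using iff upd by (cases "x(i := y i) = y") simp_all
  qed
  then show ?thesis
    using assms by (simp add: gibbs_def)
qed

lemma gibbs_stationary:
  "is_stationary (profiles n S) (logit_transition n S (\<lambda>_. U) \<beta>) (gibbs (profiles n S) U \<beta>)"
  unfolding is_stationary_def
proof (intro conjI ballI)
  interpret finite_markov_chain "profiles n S" "logit_transition n S (\<lambda>_. U) \<beta>" by (rule logit_chain)
  show "is_distribution (profiles n S) (gibbs (profiles n S) U \<beta>)"
    using nonempty_strategies
    by (intro gibbs_distribution finite_states) (auto simp: profiles_def PiE_eq_empty_iff)
  fix y assume y: "y \<in> profiles n S"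
  have "(\<Sum>x\<in>profiles n S. gibbs (profiles n S) U \<beta> x * logit_transition n S (\<lambda>_. U) \<beta> x y)
      = (\<Sum>x\<in>profiles n S. gibbs (profiles n S) U \<beta> y * logit_transition n S (\<lambda>_. U) \<beta> y x)"
    using y by (intro sum.cong refl detailed_balance)
  also have "\<dots> = gibbs (profiles n S) U \<beta> y"
    using row_sum[OF y] by (simp flip: sum_distrib_left)
  finally show "(\<Sum>x\<in>profiles n S. gibbs (profiles n S) U \<beta> x * logit_transition n S (\<lambda>_. U) \<beta> x y)
      = gibbs (profiles n S) U \<beta> y" .
qed

text \<open>The general bottleneck bound with its Doeblin hypothesis discharged by
  \<open>r = n\<close>.\<close>

lemma logit_mixing_time_bottleneck:
  assumes "A \<subseteq> profiles n S" "(\<Sum>x\<in>A. gibbs (profiles n S) U \<beta> x) \<le> 1 / 2"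
  shows "(\<Sum>x\<in>A. gibbs (profiles n S) U \<beta> x) \<le> 4 * real (logit_mixing_time n S (\<lambda>_. U) \<beta>) *
    (\<Sum>x\<in>A. \<Sum>y\<in>profiles n S - A. gibbs (profiles n S) U \<beta> x * logit_transition n S (\<lambda>_. U) \<beta> x y)"
proof -
  have "is_distribution (profiles n S) (gibbs (profiles n S) U \<beta>)"
    using gibbs_stationary is_stationary_def by blast
  then obtain \<delta> where \<delta>: "0 < \<delta>" "\<delta> \<le> 1"
    "\<And>x y. x \<in> profiles n S \<Longrightarrow> y \<in> profiles n S \<Longrightarrow> \<delta> * gibbs (profiles n S) U \<beta> y
       \<le> transition_power (profiles n S) (logit_transition n S (\<lambda>_. U) \<beta>) n x y"
    using logit_minorisation[of _ "\<lambda>_. U" \<beta>] by metis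
  show ?thesis
    unfolding logit_mixing_time_def
    by (rule finite_markov_chain.mixing_time_bottleneck[OF logit_chain gibbs_stationary \<delta>(3,1,2) assms])
qed

end

section \<open>The OR game\<close>

lemma or_game: "n \<ge> 1 \<Longrightarrow> finite_game n or_strategies"
  by unfold_locales (auto simp: or_strategies_def)

text \<open>At the zero profile every player weighs 0 with 1 and 1 with
  \<open>exp (- \<beta>)\<close>, so averaging over players changes nothing. The player index 0 in
  \<open>or_utility n 0\<close> is arbitrary, as all players share the utility.\<close>

lemma or_zero_transition:
  fixes n \<beta>
  defines "o0 \<equiv> (\<lambda>i\<in>{..<n}. 0)"
  assumes "n \<ge> 1"
  shows "logit_transition n or_strategies (\<lambda>_. or_utility n 0) \<beta> o0 o0 = 1 / (1 + exp (- \<beta>))"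
proof -
  have zero: "o0(i := 0) = o0" "or_utility n 0 o0 = 0" "or_utility n 0 (o0(i := 1)) = -1" if "i < n" for i
    using that by (auto simp: o0_def or_utility_def fun_eq_iff)
  have "o0 \<in> profiles n or_strategies"
    by (auto simp: o0_def profiles_def or_strategies_def)
  note common = finite_game.logit_transition_common[OF or_game[OF assms(2)] this]
  have "logit_transition n or_strategies (\<lambda>_. or_utility n 0) \<beta> o0 o0
      = (\<Sum>i<n. 1 / (1 + exp (- \<beta>)) / real n)"
    unfolding common
  proof (intro sum.cong refl)
    fix i assume "i \<in> {..<n}"
    then have "i < n" "o0 i = 0" by (auto simp: o0_def)
    then show "(if o0(i := o0 i) = o0 then exp (\<beta> * or_utility n 0 o0) /
        (\<Sum>z\<in>or_strategies i. exp (\<beta> * or_utility n 0 (o0(i := z)))) / real n else 0)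
      = 1 / (1 + exp (- \<beta>)) / real n"
      using zero[of i] by (simp add: or_strategies_def)
  qed
  then show ?thesis
    using assms(2) by simp
qed

text \<open>The ratio of stationary mass to the flow bound \<open>exp (- \<beta>) / Z\<close> is
  \<open>exp \<beta>\<close> for the zero profile and \<open>2 ^ n - 1\<close> for its complement.
  Each hypothesis makes the corresponding set have mass at most 1/2.\<close>

lemma or_mixing_time_lower_bounds:
  fixes n :: nat and \<beta> :: real
  assumes n: "n \<ge> 1"
  defines "T \<equiv> real (logit_mixing_time n or_strategies (or_utility n) \<beta>)"
  shows "exp \<beta> \<le> 2 ^ n - 1 \<Longrightarrow> exp \<beta> \<le> 4 * T"
    and "exp \<beta> \<ge> 2 ^ n - 1 \<Longrightarrow> 2 ^ n - 1 \<le> 4 * T"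
proof -
  define U where "U = or_utility n 0"
  define \<Omega> where "\<Omega> = profiles n or_strategies"
  define o0 where "o0 = (\<lambda>i\<in>{..<n}. 0::nat)"
  define P where "P = logit_transition n or_strategies (\<lambda>_. U) \<beta>"
  define g where "g = gibbs \<Omega> U \<beta>"
  define Z where "Z = 1 + (2 ^ n - 1) * exp (- \<beta>)"
  interpret finite_game n or_strategies by (rule or_game[OF n])
  interpret finite_markov_chain \<Omega> P
    unfolding \<Omega>_def P_def by (rule logit_chain)
  have o0: "o0 \<in> \<Omega>"
    by (auto simp: o0_def \<Omega>_def profiles_def or_strategies_def)
  have U_o0: "U o0 = 0"
    by (simp add: U_def o0_def or_utility_def)
  have U_other: "U x = -1" if "x \<in> \<Omega> - {o0}" for x
  proof -
    have "\<exists>j<n. x j \<noteq> 0"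
    proof (rule ccontr)
      assume "\<not> (\<exists>j<n. x j \<noteq> 0)"
      then have "x = o0"
        using that by (auto simp: o0_def \<Omega>_def profiles_def PiE_iff extensional_def fun_eq_iff)
      then show False using that by simp
    qed
    then show ?thesis by (auto simp: U_def or_utility_def)
  qed
  have card_\<Omega>: "card \<Omega> = 2 ^ n"
    by (simp add: \<Omega>_def profiles_def or_strategies_def card_PiE numeral_2_eq_2)
  then have card_other: "real (card (\<Omega> - {o0})) = 2 ^ n - 1"
    using o0 finite_states by (simp add: card_Diff_singleton of_nat_diff)
  have "(1::real) \<le> 2 ^ n" by simp
  then have Z_pos: "Z > 0"
    unfolding Z_def by (simp add: add_pos_nonneg)
  have "(\<Sum>x\<in>\<Omega>. exp (\<beta> * U x)) = exp (\<beta> * U o0) + (\<Sum>x\<in>\<Omega> - {o0}. exp (\<beta> * U x))"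
    by (rule sum.remove[OF finite_states o0])
  also have "\<dots> = Z"
    using card_other by (simp add: U_o0 U_other Z_def)
  finally have Z: "(\<Sum>x\<in>\<Omega>. exp (\<beta> * U x)) = Z" .
  have g_o0: "g o0 = 1 / Z" and g_other: "x \<in> \<Omega> - {o0} \<Longrightarrow> g x = exp (- \<beta>) / Z" for x
    using o0 by (simp_all add: g_def gibbs_def Z U_o0 U_other)
  have sum_other: "(\<Sum>x\<in>\<Omega> - {o0}. g x) = (2 ^ n - 1) * exp (- \<beta>) / Z"
    using card_other by (simp add: g_other)
  \<comment> \<open>The escape probability comes from the holding probability, which avoids
    enumerating the neighbours of \<open>o0\<close>.\<close>
  have "(\<Sum>y\<in>\<Omega> - {o0}. P o0 y) = 1 - P o0 o0"
    using sum.remove[OF finite_states o0, of "P o0"] row_sum[OF o0] by simp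
  also have "\<dots> = 1 - 1 / (1 + exp (- \<beta>))"
    unfolding P_def U_def o0_def using or_zero_transition[OF n] by simp
  also have "\<dots> \<le> exp (- \<beta>)"
  proof -
    have "1 + exp (- \<beta>) > 0" by (simp add: add_pos_pos)
    then show ?thesis by (simp add: divide_simps)
  qed
  finally have "(\<Sum>y\<in>\<Omega> - {o0}. g o0 * P o0 y) \<le> g o0 * exp (- \<beta>)"
    using g_o0 Z_pos by (simp add: divide_right_mono flip: sum_distrib_left sum_divide_distrib)
  then have flow: "(\<Sum>y\<in>\<Omega> - {o0}. g o0 * P o0 y) \<le> exp (- \<beta>) / Z"
    by (simp add: g_o0)
  have T_eq: "T = real (logit_mixing_time n or_strategies (\<lambda>_. U) \<beta>)"
  proof -
    have "or_utility n = (\<lambda>_. U)" by (auto simp: U_def or_utility_def fun_eq_iff)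
    then show ?thesis by (simp add: T_def)
  qed
  have T_nonneg: "T \<ge> 0" by (simp add: T_def)
  have bottleneck: "(\<Sum>x\<in>A. g x) \<le> 4 * T * (\<Sum>x\<in>A. \<Sum>y\<in>\<Omega> - A. g x * P x y)"
    if "A \<subseteq> \<Omega>" "(\<Sum>x\<in>A. g x) \<le> 1 / 2" for A
    using logit_mixing_time_bottleneck[of A U \<beta>] that
    unfolding T_eq g_def P_def \<Omega>_def by simp
  {
    assume "exp \<beta> \<le> 2 ^ n - 1"
    \<comment> \<open>The hypothesis says that the nonzero profiles have total weight at least 1,
      the weight of \<open>o0\<close>.\<close>
    then have "2 \<le> Z" by (simp add: Z_def exp_minus field_simps)
    then have "1 / Z \<le> 1 / 2" by (intro divide_left_mono) auto
    then have "1 / Z \<le> 4 * T * (\<Sum>y\<in>\<Omega> - {o0}. g o0 * P o0 y)"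
      using bottleneck[of "{o0}"] o0 g_o0 by simp
    also have "\<dots> \<le> 4 * T * (exp (- \<beta>) / Z)"
      using flow T_nonneg by (intro mult_left_mono) auto
    finally show "exp \<beta> \<le> 4 * T"
      using Z_pos by (simp add: exp_minus field_simps)
  }
  {
    assume "exp \<beta> \<ge> 2 ^ n - 1"
    then have "(2 ^ n - 1) * exp (- \<beta>) \<le> exp \<beta> * exp (- \<beta>)"
      by (intro mult_right_mono) auto
    \<comment> \<open>Now the nonzero profiles weigh at most 1, which is the rest of
      \<open>Z\<close>, hence at most half of it.\<close>
    then have "(2 ^ n - 1) * exp (- \<beta>) \<le> Z / 2"
      by (simp add: Z_def mult.commute flip: exp_add)
    then have half: "(\<Sum>x\<in>\<Omega> - {o0}. g x) \<le> 1 / 2"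
      using Z_pos by (simp add: sum_other field_simps)
    have "\<Omega> - (\<Omega> - {o0}) = {o0}" using o0 by auto
    then have "(2 ^ n - 1) * exp (- \<beta>) / Z \<le> 4 * T * (\<Sum>x\<in>\<Omega> - {o0}. g x * P x o0)"
      using bottleneck[OF _ half] by (simp add: sum_other)
    \<comment> \<open>Reversibility turns the flow into \<open>o0\<close> into the flow out of it,
      which is already bounded.\<close>
    also have "(\<Sum>x\<in>\<Omega> - {o0}. g x * P x o0) = (\<Sum>y\<in>\<Omega> - {o0}. g o0 * P o0 y)"
      using o0 unfolding g_def P_def \<Omega>_def by (intro sum.cong refl detailed_balance) auto
    also have "4 * T * \<dots> \<le> 4 * T * (exp (- \<beta>) / Z)"
      using flow T_nonneg by (intro mult_left_mono) auto
    finally have "(2 ^ n - 1) * (exp (- \<beta>) / Z) \<le> 4 * T * (exp (- \<beta>) / Z)"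
      by simp
    then show "2 ^ n - 1 \<le> 4 * T"
      by (rule mult_right_le_imp_le) (simp add: Z_pos)
  }
qed

theorem theorem11:
  shows "\<exists>C::real. C > 0 \<and>
    (\<forall>(n::nat) (\<beta>::real). n \<ge> 1 \<longrightarrow> \<beta> \<ge> 0 \<longrightarrow>
      (\<beta> < ln (2 ^ n - 1) \<longrightarrow>
         real (logit_mixing_time n or_strategies (or_utility n) \<beta>) \<ge> C * exp \<beta>) \<and>
      (\<beta> > ln (2 ^ n - 1) \<longrightarrow>
         real (logit_mixing_time n or_strategies (or_utility n) \<beta>) \<ge> C * 2 ^ n))"
proof (intro exI[of _ "1 / 8"] conjI allI impI)
  fix n :: nat and \<beta> :: real
  assume n: "n \<ge> 1"
  \<comment> \<open>The constant 1/8 comes from the second case: \<open>n \<ge> 1\<close> gives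
    \<open>2 ^ n - 1 \<ge> 2 ^ n / 2\<close>, which costs a factor 2 on top of the 4. It also makes
    the argument of \<open>ln\<close> positive, so that \<open>exp\<close> inverts it.\<close>
  have two: "(2::real) \<le> 2 ^ n"
    using power_increasing[OF n, of "2::real"] by simp
  then have pos: "(2::real) ^ n - 1 > 0" by simp
  {
    assume "\<beta> < ln (2 ^ n - 1)"
    then have "exp \<beta> \<le> 2 ^ n - 1"
      using pos by (metis exp_less_mono exp_ln less_imp_le)
    then have "exp \<beta> \<le> 4 * real (logit_mixing_time n or_strategies (or_utility n) \<beta>)"
      by (rule or_mixing_time_lower_bounds(1)[OF n])
    then show "1 / 8 * exp \<beta> \<le> real (logit_mixing_time n or_strategies (or_utility n) \<beta>)"
      using exp_gt_zero[of \<beta>] by linarith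
  }
  {
    assume "\<beta> > ln (2 ^ n - 1)"
    then have "exp \<beta> \<ge> 2 ^ n - 1"
      using pos by (metis exp_less_mono exp_ln less_imp_le)
    then have "2 ^ n - 1 \<le> 4 * real (logit_mixing_time n or_strategies (or_utility n) \<beta>)"
      by (rule or_mixing_time_lower_bounds(2)[OF n])
    then show "1 / 8 * 2 ^ n \<le> real (logit_mixing_time n or_strategies (or_utility n) \<beta>)"
      using two by linarith
  }
qed simp

end
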